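(* Let $N$ be a Nijenhuis operator on a left-symmetric conformal algebra $A$. Put $$\omega_\lambda(a,b)=(\delta N)_\lambda(a,b)=a\cdot^N_\lambda b=N(a)_\lambda b+a_\lambda N(b)-N(a_\lambda b),\qquad a,b\in A.$$ Then $\omega$ generates a linear deformation of $A$, and this linear deformation is trivial.
   Context: $A$ is finitely generated as a $\mathbb{C}[\partial]$-module. Products are extended coefficientwise to polynomials in $\lambda,\mu$. A left-symmetric conformal algebra is a $\mathbb{C}[\partial]$-module $A$ with a $\mathbb{C}$-linear map $A\otimes A\to A[\lambda]$, $a\otimes b\mapsto a_\lambda b$, such that $(\partial a)_\lambda b=-\lambda a_\lambda b$, $a_\lambda(\partial b)=(\partial+\lambda)a_\lambda b$ and $(a_\lambda b)_{\lambda+\mu}c-a_\lambda(b_\mu c)=(b_\mu a)_{\lambda+\mu}c-b_\mu(a_\lambda c)$. A homomorphism is a $\mathbb{C}[\partial]$-module homomorphism $\phi$ with $\phi(a_\lambda b)=\phi(a)_\lambda\phi(b)$. A Nijenhuis operator on $A$ is a $\mathbb{C}[\partial]$-module homomorphism $N:A\to A$ with $N(a)_\lambda N(b)=N(a\cdot^N_\lambda b)$ for all $a,b\in A$, where $a\cdot^N_\lambda b=N(a)_\lambda b+a_\lambda N(b)-N(a_\lambda b)$. $C^2(A,A)$ is the space of $\mathbb{C}$-bilinear maps $\omega_\lambda:A\times A\to A[\lambda]$ with $\omega_\lambda(\partial a,b)=-\lambda\omega_\lambda(a,b)$ and $\omega_\lambda(a,\partial b)=(\partial+\lambda)\omega_\lambda(a,b)$.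 An element $\omega\in C^2(A,A)$ generates a linear deformation of $A$ if for all parameter values $t$ the product $a\cdot^\omega_\lambda b=a_\lambda b+t\,\omega_\lambda(a,b)$ is a left-symmetric conformal algebra structure on $A$. The linear deformation is trivial if there is a $\mathbb{C}[\partial]$-module homomorphism $N':A\to A$ such that, for all $t$, $T_t=\mathrm{id}+tN'$ is a homomorphism of left-symmetric conformal algebras from $(A,\cdot^\omega_\lambda)$ to $A$. *)

theory Defs
  imports Complex_Main "HOL-Computational_Algebra.Polynomial"
begin

text \<open>
  A \<open>\<complex>[\<partial>]\<close>-module is a \<^locale>\<open>module\<close> over the ring \<^typ>\<open>complex poly\<close>; the indeterminate of
  \<^typ>\<open>complex poly\<close> is \<open>\<partial>\<close>, and \<open>\<complex>\<close> acts through the constant polynomials.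
\<close>

definition del :: "(complex poly \<Rightarrow> 'a \<Rightarrow> 'a) \<Rightarrow> 'a \<Rightarrow> 'a" where
  "del s a = s [:0, 1:] a"

definition cscale :: "(complex poly \<Rightarrow> 'a \<Rightarrow> 'a) \<Rightarrow> complex \<Rightarrow> 'a \<Rightarrow> 'a" where
  "cscale s c a = s [:c:] a"

definition finitely_generated :: "(complex poly \<Rightarrow> 'a::ab_group_add \<Rightarrow> 'a) \<Rightarrow> bool" where
  "finitely_generated s \<longleftrightarrow> (\<exists>S. finite S \<and> module.span s S = UNIV)"

text \<open>
  \<open>A[\<lambda>]\<close> is \<^typ>\<open>'a poly\<close>: a map of \<open>A\<close> acts on it coefficientwise by \<^const>\<open>map_poly\<close>, and
  multiplication by \<open>\<lambda>\<close> is \<^term>\<open>pCons 0\<close>.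
\<close>

definition cochains2 ::
    "(complex poly \<Rightarrow> 'a::ab_group_add \<Rightarrow> 'a) \<Rightarrow> ('a \<Rightarrow> 'a \<Rightarrow> 'a poly) set" where
  "cochains2 s = {\<omega>.
     (\<forall>b. Vector_Spaces.linear (cscale s) (\<lambda>c. map_poly (cscale s c)) (\<lambda>a. \<omega> a b)) \<and>
     (\<forall>a. Vector_Spaces.linear (cscale s) (\<lambda>c. map_poly (cscale s c)) (\<lambda>b. \<omega> a b)) \<and>
     (\<forall>a b. \<omega> (del s a) b = - pCons 0 (\<omega> a b)) \<and>
     (\<forall>a b. \<omega> a (del s b) = map_poly (del s) (\<omega> a b) + pCons 0 (\<omega> a b))}"

text \<open>
  \<open>A[\<lambda>,\<mu>]\<close> is \<^typ>\<open>'a poly poly\<close> with outer variable \<open>\<mu>\<close> and inner variable \<open>\<lambda>\<close>. The operators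
  below are the multiplications by \<open>\<lambda>\<close>, by \<open>\<mu>\<close> and by \<open>\<lambda> + \<mu>\<close>.
\<close>

definition mult_lam :: "'a::ab_group_add poly poly \<Rightarrow> 'a poly poly" where
  "mult_lam X = map_poly (pCons 0) X"

definition mult_mu :: "'a::ab_group_add poly poly \<Rightarrow> 'a poly poly" where
  "mult_mu X = pCons 0 X"

definition mult_lam_mu :: "'a::ab_group_add poly poly \<Rightarrow> 'a poly poly" where
  "mult_lam_mu X = mult_lam X + mult_mu X"

text \<open>
  If \<open>T\<close> is multiplication by \<open>z\<close>, then \<open>extend T f (\<Sum>i. x\<^sub>i \<lambda>\<^sup>i) = \<Sum>i. z\<^sup>i f(x\<^sub>i)\<close>:
  the map \<open>f\<close> is extended coefficientwise and the variable is renamed to \<open>z\<close>.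
\<close>

definition extend :: "('b \<Rightarrow> 'b) \<Rightarrow> ('a::zero \<Rightarrow> 'b::comm_monoid_add) \<Rightarrow> 'a poly \<Rightarrow> 'b" where
  "extend T f p = (\<Sum>i\<le>degree p. (T ^^ i) (f (coeff p i)))"

text \<open>\<open>at_var T p\<close> is \<open>p(z) \<in> A[\<lambda>,\<mu>]\<close> for \<open>p \<in> A[\<lambda>]\<close>, where \<open>T\<close> is multiplication by \<open>z\<close>.\<close>

definition at_var ::
    "('a::ab_group_add poly poly \<Rightarrow> 'a poly poly) \<Rightarrow> 'a poly \<Rightarrow> 'a poly poly" where
  "at_var T p = extend T (\<lambda>x. [:[:x:]:]) p"

locale lsc_algebra = module s
  for s :: "complex poly \<Rightarrow> 'a::ab_group_add \<Rightarrow> 'a" +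
  fixes P :: "'a \<Rightarrow> 'a \<Rightarrow> 'a poly"
  assumes sesquilinear: "P \<in> cochains2 s"
    \<comment> \<open>the conditions on a \<open>\<lambda>\<close>-product other than left symmetry are those defining \<open>C\<^sup>2(A,A)\<close>\<close>
  and left_symmetric:
    \<comment> \<open>\<open>(a\<^sub>\<lambda> b)\<^sub>\<lambda>\<^sub>+\<^sub>\<mu> c - a\<^sub>\<lambda> (b\<^sub>\<mu> c) = (b\<^sub>\<mu> a)\<^sub>\<lambda>\<^sub>+\<^sub>\<mu> c - b\<^sub>\<mu> (a\<^sub>\<lambda> c)\<close>\<close>
    "extend mult_lam (\<lambda>x. at_var mult_lam_mu (P x c)) (P a b)
       - extend mult_mu (\<lambda>x. at_var mult_lam (P a x)) (P b c)
     = extend mult_mu (\<lambda>x. at_var mult_lam_mu (P x c)) (P b a)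
       - extend mult_lam (\<lambda>x. at_var mult_mu (P b x)) (P a c)"

locale lsc_hom = A: lsc_algebra s P + B: lsc_algebra s' P' + module_hom s s' \<phi>
  for s :: "complex poly \<Rightarrow> 'a::ab_group_add \<Rightarrow> 'a" and P
  and s' :: "complex poly \<Rightarrow> 'b::ab_group_add \<Rightarrow> 'b" and P'
  and \<phi> :: "'a \<Rightarrow> 'b" +
  assumes map_prod: "map_poly \<phi> (P a b) = P' (\<phi> a) (\<phi> b)"

definition nijenhuis_prod ::
    "('a::ab_group_add \<Rightarrow> 'a \<Rightarrow> 'a poly) \<Rightarrow> ('a \<Rightarrow> 'a) \<Rightarrow> 'a \<Rightarrow> 'a \<Rightarrow> 'a poly" where
  "nijenhuis_prod P N a b = P (N a) b + P a (N b) - map_poly N (P a b)"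

definition nijenhuis_operator ::
    "(complex poly \<Rightarrow> 'a::ab_group_add \<Rightarrow> 'a) \<Rightarrow> ('a \<Rightarrow> 'a \<Rightarrow> 'a poly) \<Rightarrow> ('a \<Rightarrow> 'a) \<Rightarrow> bool" where
  "nijenhuis_operator s P N \<longleftrightarrow>
     module_hom s s N \<and> (\<forall>a b. P (N a) (N b) = map_poly N (nijenhuis_prod P N a b))"

definition deformed_prod ::
    "(complex poly \<Rightarrow> 'a::ab_group_add \<Rightarrow> 'a) \<Rightarrow> ('a \<Rightarrow> 'a \<Rightarrow> 'a poly) \<Rightarrow>
     ('a \<Rightarrow> 'a \<Rightarrow> 'a poly) \<Rightarrow> complex \<Rightarrow> 'a \<Rightarrow> 'a \<Rightarrow> 'a poly" where
  "deformed_prod s P \<omega> t a b = P a b + map_poly (cscale s t) (\<omega> a b)"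

definition generates_linear_deformation ::
    "(complex poly \<Rightarrow> 'a::ab_group_add \<Rightarrow> 'a) \<Rightarrow> ('a \<Rightarrow> 'a \<Rightarrow> 'a poly) \<Rightarrow>
     ('a \<Rightarrow> 'a \<Rightarrow> 'a poly) \<Rightarrow> bool" where
  "generates_linear_deformation s P \<omega> \<longleftrightarrow>
     \<omega> \<in> cochains2 s \<and> (\<forall>t. lsc_algebra s (deformed_prod s P \<omega> t))"

definition trivial_linear_deformation ::
    "(complex poly \<Rightarrow> 'a::ab_group_add \<Rightarrow> 'a) \<Rightarrow> ('a \<Rightarrow> 'a \<Rightarrow> 'a poly) \<Rightarrow>
     ('a \<Rightarrow> 'a \<Rightarrow> 'a poly) \<Rightarrow> bool" where
  "trivial_linear_deformation s P \<omega> \<longleftrightarrow>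
     (\<exists>N'. module_hom s s N' \<and>
       (\<forall>t. lsc_hom s (deformed_prod s P \<omega> t) s P (\<lambda>a. a + cscale s t (N' a))))"

end

theory Submission imports Defs begin

text \<open>
  The deformed product is itself a Nijenhuis product: with \<open>T = id + t N\<close> one has
  \<open>a\<^sub>\<lambda> b + t \<omega>\<^sub>\<lambda>(a,b) = T(a)\<^sub>\<lambda> b + a\<^sub>\<lambda> T(b) - T(a\<^sub>\<lambda> b)\<close>, and \<open>T\<close> is again a Nijenhuis
  operator. So it suffices to see that the product \<open>\<cdot>\<^sup>T\<close> of any Nijenhuis operator \<open>T\<close> is left
  symmetric; \<open>T\<close> is then a homomorphism by the Nijenhuis identity. Each iterated product of
  \<open>\<cdot>\<^sup>T\<close>, as a function of \<open>a, b, c\<close>, arises from the corresponding iterated product \<open>F\<close> of \<open>A\<close> as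
  \<open>F(Ta,Tb,c) + F(Ta,b,Tc) + F(a,Tb,Tc) - T(F(Ta,b,c) + F(a,Tb,c) + F(a,b,Tc)) + T\<^sup>2 F(a,b,c)\<close>.
  This expression is linear in \<open>F\<close> and compatible with exchanging \<open>a\<close> and \<open>b\<close>, so it carries the
  left-symmetry identity of \<open>A\<close> over to \<open>\<cdot>\<^sup>T\<close>.
\<close>

section \<open>Additive maps and the extension operator \<open>extend\<close>\<close>

lemma additive_map_poly:
  assumes "additive f"
  shows "additive (map_poly f)"
proof -
  interpret additive f by fact
  show ?thesis by standard (simp add: poly_eq_iff coeff_map_poly zero add)
qed

lemma additive_pCons_0: "additive (pCons (0::'a::ab_group_add))"
  by standard simp

lemma additive_funpow:
  fixes T :: "'a::ab_group_add \<Rightarrow> 'a"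
  assumes "additive T"
  shows "additive (T ^^ i)"
proof
  show "(T ^^ i) (x + y) = (T ^^ i) x + (T ^^ i) y" for x y
    by (induction i) (simp_all add: additive.add[OF assms])
qed

text \<open>The terms beyond \<open>degree p\<close> vanish, since \<open>f 0 = 0\<close> and the
  powers of \<open>T\<close> are additive. This frees the summation range from \<open>p\<close>, so
  that polynomials of different degrees can be compared term by term.\<close>

lemma extend_eq_sum:
  assumes "additive T" "f 0 = 0" "degree p \<le> n"
  shows "extend T f p = (\<Sum>i\<le>n. (T ^^ i) (f (coeff p i)))"
  unfolding extend_def
  by (rule sum.mono_neutral_left)
    (use assms in \<open>auto simp: coeff_eq_0 additive.zero[OF additive_funpow]\<close>)

lemma additive_extend:
  fixes f :: "'a::ab_group_add \<Rightarrow> 'b::ab_group_add"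
  assumes T: "additive T" and f: "additive f"
  shows "additive (extend T f)"
proof
  fix p q :: "'a poly"
  define n where "n = max (degree p) (degree q)"
  have "degree (p + q) \<le> n" "degree p \<le> n" "degree q \<le> n"
    by (simp_all add: n_def degree_add_le_max)
  then show "extend T f (p + q) = extend T f p + extend T f q"
    by (simp add: extend_eq_sum[where n = n] T additive.zero[OF f] additive.add[OF f]
        additive.add[OF additive_funpow[OF T]] sum.distrib)
qed

lemma extend_add_fun:
  assumes "additive T"
  shows "extend T (\<lambda>x. f x + g x) p = extend T f p + extend T g p"
  by (simp add: extend_def additive.add[OF additive_funpow[OF assms]] sum.distrib)

lemma extend_diff_fun:
  assumes "additive T"
  shows "extend T (\<lambda>x. f x - g x) p = extend T f p - extend T g p"
  by (simp add: extend_def additive.diff[OF additive_funpow[OF assms]] sum_subtractf)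

lemma extend_map_poly:
  assumes "additive T" "f 0 = 0" "g 0 = 0"
  shows "extend T f (map_poly g p) = extend T (\<lambda>x. f (g x)) p"
  using assms
  by (simp add: extend_eq_sum[where n = "degree p"] map_poly_degree_leq coeff_map_poly)

lemma map_extend:
  assumes M: "additive M" and comm: "\<And>X. M (T X) = T (M X)"
  shows "M (extend T f p) = extend T (\<lambda>x. M (f x)) p"
proof -
  have "M ((T ^^ i) X) = (T ^^ i) (M X)" for i X
    by (induction i) (simp_all add: comm)
  then show ?thesis by (simp add: extend_def additive.sum[OF M])
qed

section \<open>Multiplication by the variables and coefficientwise maps\<close>

lemma additive_mult_lam: "additive mult_lam"
  unfolding mult_lam_def by (rule additive_map_poly) (rule additive_pCons_0)

lemma additive_mult_mu: "additive mult_mu"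
  unfolding mult_mu_def by (rule additive_pCons_0)

lemma additive_mult_lam_mu: "additive mult_lam_mu"
  by standard
    (simp add: mult_lam_mu_def additive.add[OF additive_mult_lam] additive.add[OF additive_mult_mu])

lemma additive_at_var:
  assumes "additive T"
  shows "additive (at_var T)"
proof -
  have "additive (\<lambda>x::'a. [:[:x:]:])" by standard simp
  with additive_extend[OF assms this] show ?thesis by (simp add: at_var_def[abs_def])
qed

lemma map_poly_pCons_0:
  assumes "f 0 = 0"
  shows "map_poly f (pCons 0 p) = pCons 0 (map_poly f p)"
  using assms by (simp add: poly_eq_iff coeff_map_poly coeff_pCons split: nat.split)

lemma map_mult_mu:
  "map_poly (map_poly f) (mult_mu X) = mult_mu (map_poly (map_poly f) X)"
  by (simp add: mult_mu_def map_poly_pCons_0)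

lemma map_mult_lam:
  assumes "additive f"
  shows "map_poly (map_poly f) (mult_lam X) = mult_lam (map_poly (map_poly f) X)"
  by (simp add: mult_lam_def poly_eq_iff coeff_map_poly coeff_pCons additive.zero[OF assms]
      split: nat.split)

lemma map_mult_lam_mu:
  assumes "additive f"
  shows "map_poly (map_poly f) (mult_lam_mu X) = mult_lam_mu (map_poly (map_poly f) X)"
  by (simp add: mult_lam_mu_def map_mult_mu map_mult_lam assms
      additive.add[OF additive_map_poly[OF additive_map_poly[OF assms]]])

text \<open>Renaming the variable does not touch the coefficients, so \<open>N\<close> passes
  through \<open>at_var\<close>. This supplies the hypothesis \<open>WN\<close> of the lemmas on
  iterated products.\<close>

lemma at_var_map_poly:
  assumes N: "additive N" and T: "additive T"
    and comm: "\<And>X. map_poly (map_poly N) (T X) = T (map_poly (map_poly N) X)"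
  shows "at_var T (map_poly N p) = map_poly (map_poly N) (at_var T p)"
proof -
  note z = additive.zero[OF N]
  have "map_poly (map_poly N) (at_var T p) = extend T (\<lambda>x. map_poly (map_poly N) [:[:x:]:]) p"
    unfolding at_var_def
    by (rule map_extend) (intro additive_map_poly N comm)+
  also have "(\<lambda>x. map_poly (map_poly N) [:[:x:]:]) = (\<lambda>x. [:[:N x:]:])"
    by (simp add: fun_eq_iff poly_eq_iff coeff_map_poly coeff_pCons z split: nat.split)
  finally show ?thesis by (simp add: at_var_def extend_map_poly T z)
qed

section \<open>Iterated Nijenhuis products\<close>

text \<open>A signed sum over the proper subsets S of the three arguments: \<open>N\<close> acts on
  the arguments in S, \<open>M\<close> is applied 2 - |S| times to the value, and the sign is
  (-1)^|S|. \<open>M\<close> is separate from \<open>N\<close> because \<open>F\<close> will take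
  values in \<open>A[\<lambda>,\<mu>]\<close>, where \<open>N\<close> acts coefficientwise.\<close>

definition nijenhuis_ternary ::
    "('a \<Rightarrow> 'a) \<Rightarrow> ('b \<Rightarrow> 'b) \<Rightarrow> ('a \<Rightarrow> 'a \<Rightarrow> 'a \<Rightarrow> 'b::ab_group_add) \<Rightarrow> 'a \<Rightarrow> 'a \<Rightarrow> 'a \<Rightarrow> 'b" where
  "nijenhuis_ternary N M F a b c = F (N a) (N b) c + F (N a) b (N c) + F a (N b) (N c)
     - M (F (N a) b c + F a (N b) c + F a b (N c)) + M (M (F a b c))"

text \<open>The Nijenhuis identity is used twice: on \<open>N a\<close>, \<open>N b\<close>, and on
  \<open>N x\<close>, \<open>N c\<close> for each coefficient \<open>x\<close> of
  \<open>P a b\<close>. \<open>T\<close> stands for multiplication by the variable of the inner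
  product and \<open>W\<close> for substitution into the outer one, so one lemma covers all choices
  of variables.\<close>

lemma nijenhuis_prod_iterated_left:
  fixes P :: "'a::ab_group_add \<Rightarrow> 'a \<Rightarrow> 'a poly"
    and W :: "'a poly \<Rightarrow> 'b::ab_group_add"
  assumes P1: "\<And>b. additive (\<lambda>a. P a b)"
    and N: "additive N"
    and nij: "\<And>a b. P (N a) (N b) = map_poly N (nijenhuis_prod P N a b)"
    and T: "additive T" and W: "additive W" and M: "additive M"
    and MT: "\<And>X. M (T X) = T (M X)"
    and WN: "\<And>p. W (map_poly N p) = M (W p)"
  shows "extend T (\<lambda>x. W (nijenhuis_prod P N x c)) (nijenhuis_prod P N a b)
    = nijenhuis_ternary N M (\<lambda>a b c. extend T (\<lambda>x. W (P x c)) (P a b)) a b c"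
proof -
  define F where "F = (\<lambda>a b c. extend T (\<lambda>x. W (P x c)) (P a b))"
  define Q where "Q = nijenhuis_prod P N"
  define E where "E c = extend T (\<lambda>x. W (P x c))" for c
  note zN = additive.zero[OF N]
  have FE: "F a b c = E c (P a b)" for a b c
    by (simp add: F_def E_def)
  have f: "additive (\<lambda>x. W (P x c))" for c
    by standard (simp add: additive.add[OF W] additive.add[OF P1])
  have E: "additive (E c)" for c
    unfolding E_def by (rule additive_extend[OF T f])
  have EN: "extend T (\<lambda>x. W (P (N x) c)) p = E c (map_poly N p)" for c p
    unfolding E_def
    by (rule extend_map_poly[symmetric]) (rule T zN additive.zero[OF f])+
  have Mext: "extend T (\<lambda>x. M (g x)) p = M (extend T g p)" for g :: "'a \<Rightarrow> 'b" and p
    by (rule map_extend[symmetric]) (rule M MT)+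
  have WQ: "W (Q x c) = W (P (N x) c) + W (P x (N c)) - M (W (P x c))" for x c
    by (simp add: Q_def nijenhuis_prod_def additive.add[OF W] additive.diff[OF W] WN)
  have EQ: "extend T (\<lambda>x. W (Q x c)) p = E c (map_poly N p) + E (N c) p - M (E c p)" for c p
    unfolding WQ extend_diff_fun[OF T] extend_add_fun[OF T] EN Mext by (simp add: E_def)
  have Qab: "E c (Q a b) = F (N a) b c + F a (N b) c - E c (map_poly N (P a b))" for c
    by (simp add: Q_def nijenhuis_prod_def additive.add[OF E] additive.diff[OF E] FE)
  \<comment> \<open>Second use of the identity: this term has \<open>N\<close> around the inner
    product and so is not a value of \<open>F\<close>; it has to be eliminated.\<close>
  have "E (N c) (map_poly N (P a b)) = extend T (\<lambda>x. W (P (N x) (N c))) (P a b)"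
    by (simp add: EN)
  also have "\<dots> = extend T (\<lambda>x. M (W (Q x c))) (P a b)"
    by (simp add: nij WN Q_def)
  also have "\<dots> = M (E c (map_poly N (P a b)) + F a b (N c) - M (F a b c))"
    by (simp add: Mext EQ FE)
  finally have NN: "E (N c) (map_poly N (P a b)) = \<dots>" .
  have "extend T (\<lambda>x. W (Q x c)) (Q a b)
      = E c (P (N a) (N b)) + E (N c) (Q a b) - M (E c (Q a b))"
    by (simp add: EQ nij flip: Q_def)
  also have "E c (P (N a) (N b)) = F (N a) (N b) c"
    by (simp add: FE)
  \<comment> \<open>By \<open>NN\<close>, the two occurrences of
    \<open>M (E c (map_poly N (P a b)))\<close> cancel.\<close>
  finally show ?thesis
    by (simp add: Qab NN additive.add[OF M] additive.diff[OF M] nijenhuis_ternary_def flip: Q_def F_def)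
qed

text \<open>Passing to the opposite product turns right-nested products into left-nested ones, and
  forming the Nijenhuis product commutes with this passage.\<close>

lemma nijenhuis_prod_iterated_right:
  fixes P :: "'a::ab_group_add \<Rightarrow> 'a \<Rightarrow> 'a poly"
    and W :: "'a poly \<Rightarrow> 'b::ab_group_add"
  assumes P2: "\<And>a. additive (P a)"
    and N: "additive N"
    and nij: "\<And>a b. P (N a) (N b) = map_poly N (nijenhuis_prod P N a b)"
    and T: "additive T" and W: "additive W" and M: "additive M"
    and MT: "\<And>X. M (T X) = T (M X)"
    and WN: "\<And>p. W (map_poly N p) = M (W p)"
  shows "extend T (\<lambda>x. W (nijenhuis_prod P N a x)) (nijenhuis_prod P N b c)
    = nijenhuis_ternary N M (\<lambda>a b c. extend T (\<lambda>x. W (P a x)) (P b c)) a b c"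
proof -
  have op: "nijenhuis_prod (\<lambda>x y. P y x) N x y = nijenhuis_prod P N y x" for x y
    by (simp add: nijenhuis_prod_def add.commute)
  \<comment> \<open>The instantiation reverses the three factors: \<open>c\<close> comes first and
    \<open>a\<close> last. \<open>nijenhuis_ternary\<close> is symmetric under this reversal up to
    the order of summands.\<close>
  show ?thesis
    using nijenhuis_prod_iterated_left[of "\<lambda>x y. P y x" N T W M a c b, unfolded op,
        OF P2 N nij T W M MT WN]
    by (simp add: nijenhuis_ternary_def ac_simps)
qed

section \<open>Sesquilinearity of the Nijenhuis product\<close>

lemma cochains2_additive:
  assumes "P \<in> cochains2 s"
  shows "additive (\<lambda>a. P a b)" and "additive (P a)"
  using assms
  by (auto simp: cochains2_def Vector_Spaces.linear_def module_hom_def module_hom_axioms_def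
      additive_def)

lemma module_hom_additive:
  assumes "module_hom s s' f"
  shows "additive f"
  by (simp add: additive_def module_hom.add[OF assms])

lemma module_hom_del:
  assumes "module_hom s s' f"
  shows "f (del s a) = del s' (f a)"
  by (simp add: del_def module_hom.scale[OF assms])

lemma module_hom_cscale:
  assumes "module_hom s s' f"
  shows "f (cscale s c a) = cscale s' c (f a)"
  by (simp add: cscale_def module_hom.scale[OF assms])

lemma linear_alt:
  "Vector_Spaces.linear s s' f \<longleftrightarrow> vector_space s \<and> vector_space s' \<and> additive f \<and>
    (\<forall>c x. f (s c x) = s' c (f x))"
  by (auto simp: Vector_Spaces.linear_def module_hom_def module_hom_axioms_def additive_def
      module_iff_vector_space)

lemma additive_cscale:
  assumes "module s"
  shows "additive (cscale s c)"
  by (simp add: additive_def cscale_def module.scale_right_distrib[OF assms])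

lemma additive_del:
  assumes "module s"
  shows "additive (del s)"
  by (simp add: additive_def del_def module.scale_right_distrib[OF assms])

lemma map_poly_comm:
  assumes "additive f" "additive g" "\<And>x. f (g x) = g (f x)"
  shows "map_poly f (map_poly g p) = map_poly g (map_poly f p)"
  using assms by (simp add: poly_eq_iff coeff_map_poly additive.zero)

text \<open>Being a module homomorphism, \<open>N\<close> commutes coefficientwise with scalars,
  with \<open>del s\<close> and with multiplication by the variable, so each of the three summands
  inherits the conditions from \<open>P\<close>.\<close>

lemma nijenhuis_prod_cochains2:
  assumes s: "module s" and P: "P \<in> cochains2 s" and N: "module_hom s s N"
  shows "nijenhuis_prod P N \<in> cochains2 s"
proof -
  note aN = module_hom_additive[OF N]
  note P' = P[unfolded cochains2_def linear_alt mem_Collect_eq]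
  note aP = cochains2_additive[OF P]
  note a = additive_map_poly[OF aN] additive_map_poly[OF additive_cscale[OF s]]
    additive_map_poly[OF additive_del[OF s]]
  note adds = aP[THEN additive.add] aN[THEN additive.add] a[THEN additive.add]
    a[THEN additive.diff] a[THEN additive.minus]
  have c: "map_poly N (map_poly (cscale s k) p) = map_poly (cscale s k) (map_poly N p)" for k p
    by (rule map_poly_comm) (rule aN additive_cscale[OF s] module_hom_cscale[OF N])+
  have d: "map_poly N (map_poly (del s) p) = map_poly (del s) (map_poly N p)" for p
    by (rule map_poly_comm) (rule aN additive_del[OF s] module_hom_del[OF N])+
  have e: "map_poly N (pCons 0 p) = pCons 0 (map_poly N p)" for p
    by (rule map_poly_pCons_0) (rule additive.zero[OF aN])
  have "additive (\<lambda>a. nijenhuis_prod P N a b)" "additive (nijenhuis_prod P N a)" for a b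
    by (simp_all add: additive_def nijenhuis_prod_def adds)
  \<comment> \<open>The \<open>vector_space\<close> conjuncts of \<open>linear_alt\<close> concern
    only the scalar actions and are taken over from \<open>P'\<close>.\<close>
  with P' show ?thesis
    unfolding cochains2_def linear_alt mem_Collect_eq
    by (simp add: nijenhuis_prod_def adds module_hom_del[OF N] module_hom_cscale[OF N] c d e)
qed

section \<open>Left symmetry of the Nijenhuis product\<close>

lemma nijenhuis_prod_lsc_algebra:
  assumes A: "lsc_algebra s P" and nij: "nijenhuis_operator s P N"
  shows "lsc_algebra s (nijenhuis_prod P N)"
proof -
  interpret lsc_algebra s P by fact
  have N: "module_hom s s N"
    and nij: "\<And>a b. P (N a) (N b) = map_poly N (nijenhuis_prod P N a b)"
    using nij by (auto simp: nijenhuis_operator_def)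
  note aN = module_hom_additive[OF N]
  note aP = cochains2_additive[OF sesquilinear]
  let ?M = "map_poly (map_poly N)"
  have M: "additive ?M" by (intro additive_map_poly aN)
  let ?Q = "nijenhuis_prod P N"
  note muls = additive_mult_lam additive_mult_mu additive_mult_lam_mu
  note map_mult = map_mult_lam[OF aN] map_mult_mu map_mult_lam_mu[OF aN]
  \<comment> \<open>The four terms of left symmetry as trilinear maps. \<open>F3\<close> and
    \<open>F4\<close> are \<open>F1\<close> and \<open>F2\<close> with the inner variable changed;
    in the identity they occur with \<open>a\<close> and \<open>b\<close> exchanged.\<close>
  define F1 where "F1 = (\<lambda>a b c. extend mult_lam (\<lambda>x. at_var mult_lam_mu (P x c)) (P a b))"
  define F2 where "F2 = (\<lambda>a b c. extend mult_mu (\<lambda>x. at_var mult_lam (P a x)) (P b c))"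
  define F3 where "F3 = (\<lambda>a b c. extend mult_mu (\<lambda>x. at_var mult_lam_mu (P x c)) (P a b))"
  define F4 where "F4 = (\<lambda>a b c. extend mult_lam (\<lambda>x. at_var mult_mu (P a x)) (P b c))"
  have Q1: "extend mult_lam (\<lambda>x. at_var mult_lam_mu (?Q x c)) (?Q a b)
      = nijenhuis_ternary N ?M F1 a b c" for a b c
    unfolding F1_def
    by (rule nijenhuis_prod_iterated_left[where P = P and N = N and M = ?M and T = mult_lam
          and W = "at_var mult_lam_mu"])
      (intro aP aN nij M muls additive_at_var map_mult at_var_map_poly)+
  have Q2: "extend mult_mu (\<lambda>x. at_var mult_lam (?Q a x)) (?Q b c)
      = nijenhuis_ternary N ?M F2 a b c" for a b c
    unfolding F2_def
    by (rule nijenhuis_prod_iterated_right[where P = P and N = N and M = ?M and T = mult_mu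
          and W = "at_var mult_lam"])
      (intro aP aN nij M muls additive_at_var map_mult at_var_map_poly)+
  have Q3: "extend mult_mu (\<lambda>x. at_var mult_lam_mu (?Q x c)) (?Q a b)
      = nijenhuis_ternary N ?M F3 a b c" for a b c
    unfolding F3_def
    by (rule nijenhuis_prod_iterated_left[where P = P and N = N and M = ?M and T = mult_mu
          and W = "at_var mult_lam_mu"])
      (intro aP aN nij M muls additive_at_var map_mult at_var_map_poly)+
  have Q4: "extend mult_lam (\<lambda>x. at_var mult_mu (?Q a x)) (?Q b c)
      = nijenhuis_ternary N ?M F4 a b c" for a b c
    unfolding F4_def
    by (rule nijenhuis_prod_iterated_right[where P = P and N = N and M = ?M and T = mult_lam
          and W = "at_var mult_mu"])
      (intro aP aN nij M muls additive_at_var map_mult at_var_map_poly)+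
  \<comment> \<open>Left symmetry solved for \<open>F1\<close>, so that rewriting removes every
    \<open>F1\<close> from the expanded ternary expressions.\<close>
  have ls: "F1 a b c = F2 a b c + F3 b a c - F4 b a c" for a b c
    using left_symmetric[of c a b] by (simp add: F1_def F2_def F3_def F4_def algebra_simps)
  show ?thesis
  proof
    show "nijenhuis_prod P N \<in> cochains2 s"
      by (rule nijenhuis_prod_cochains2[OF module_axioms sesquilinear N])
    show "extend mult_lam (\<lambda>x. at_var mult_lam_mu (nijenhuis_prod P N x c)) (nijenhuis_prod P N a b)
       - extend mult_mu (\<lambda>x. at_var mult_lam (nijenhuis_prod P N a x)) (nijenhuis_prod P N b c)
     = extend mult_mu (\<lambda>x. at_var mult_lam_mu (nijenhuis_prod P N x c)) (nijenhuis_prod P N b a)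
       - extend mult_lam (\<lambda>x. at_var mult_mu (nijenhuis_prod P N b x)) (nijenhuis_prod P N a c)"
      for a b c
      unfolding Q1 Q2 Q3 Q4
      by (simp add: nijenhuis_ternary_def ls additive.add[OF M] additive.diff[OF M])
  qed
qed

lemma nijenhuis_operator_lsc_hom:
  assumes "lsc_algebra s P" and "nijenhuis_operator s P N"
  shows "lsc_hom s (nijenhuis_prod P N) s P N"
  using assms nijenhuis_prod_lsc_algebra[OF assms]
  by (auto simp: lsc_hom_def lsc_hom_axioms_def nijenhuis_operator_def)

section \<open>The operators id + tN and the linear deformation\<close>

text \<open>Compare powers of \<open>t\<close>. In the product of id + tN the terms free of
  \<open>t\<close> are two copies of \<open>P a b\<close> minus one, and the terms in
  \<open>t\<close> form \<open>nijenhuis_prod P N a b\<close>. In the Nijenhuis identity for id + tN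
  the terms in \<open>t\<close> agree by the definition of \<open>nijenhuis_prod\<close>, those in
  \<open>t^2\<close> by the identity for \<open>N\<close>.\<close>

lemma
  assumes A: "lsc_algebra s P" and nij: "nijenhuis_operator s P N"
  shows nijenhuis_operator_id_plus: "nijenhuis_operator s P (\<lambda>a. a + cscale s t (N a))"
    and nijenhuis_prod_id_plus: "nijenhuis_prod P (\<lambda>a. a + cscale s t (N a))
      = deformed_prod s P (nijenhuis_prod P N) t"
proof -
  interpret lsc_algebra s P by fact
  define T where "T = (\<lambda>a. a + cscale s t (N a))"
  define C where "C = map_poly (cscale s t)"
  have N: "module_hom s s N"
    and nij: "\<And>a b. P (N a) (N b) = map_poly N (nijenhuis_prod P N a b)"
    using nij by (auto simp: nijenhuis_operator_def)
  interpret N: module_hom s s N by fact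
  note aN = module_hom_additive[OF N]
  note aP = cochains2_additive[OF sesquilinear]
  note ac = additive_cscale[OF module_axioms, of t]
  have C: "additive C" unfolding C_def by (rule additive_map_poly[OF ac])
  have T: "module_hom s s T"
    by unfold_locales
      (simp_all add: T_def cscale_def N.add N.scale scale_right_distrib mult.commute)
  have mT: "map_poly T p = p + C (map_poly N p)" for p
    by (simp add: poly_eq_iff coeff_map_poly T_def C_def additive.zero[OF ac])
  have PC: "P (cscale s t a) b = C (P a b)" "P a (cscale s t b) = C (P a b)" for a b
    using sesquilinear by (auto simp: cochains2_def linear_alt C_def)
  have CN: "map_poly N (C p) = C (map_poly N p)" for p
    unfolding C_def by (rule map_poly_comm) (rule aN ac module_hom_cscale[OF N])+
  note adds = aP[THEN additive.add] C[THEN additive.add] C[THEN additive.diff]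
    additive_map_poly[OF aN, THEN additive.add] additive_map_poly[OF aN, THEN additive.diff]
  have Q: "nijenhuis_prod P T a b = P a b + C (nijenhuis_prod P N a b)" for a b
    unfolding nijenhuis_prod_def mT by (simp add: T_def adds PC)
  then show "nijenhuis_prod P (\<lambda>a. a + cscale s t (N a))
      = deformed_prod s P (nijenhuis_prod P N) t"
    by (simp add: fun_eq_iff deformed_prod_def C_def flip: T_def)
  have "P (T a) (T b) = map_poly T (nijenhuis_prod P T a b)" for a b
  proof -
    \<comment> \<open>\<open>C\<close> is multiplication by \<open>t\<close>, so the summands are
      sorted by powers of \<open>t\<close>.\<close>
    have "P (T a) (T b) = P a b + C (P (N a) b + P a (N b)) + C (C (P (N a) (N b)))"
      by (simp add: T_def adds PC)
    also have "\<dots> = map_poly T (nijenhuis_prod P T a b)"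
      unfolding Q mT nij by (simp add: adds CN) (simp add: nijenhuis_prod_def adds)
    finally show ?thesis .
  qed
  with T show "nijenhuis_operator s P (\<lambda>a. a + cscale s t (N a))"
    by (simp add: nijenhuis_operator_def flip: T_def)
qed

theorem theorem4p5:
  fixes s :: "complex poly \<Rightarrow> 'a::ab_group_add \<Rightarrow> 'a"
    and P :: "'a \<Rightarrow> 'a \<Rightarrow> 'a poly"
    and N :: "'a \<Rightarrow> 'a"
    and \<omega> :: "'a \<Rightarrow> 'a \<Rightarrow> 'a poly"
  assumes "lsc_algebra s P"
    and "finitely_generated s"
    and "nijenhuis_operator s P N"
    and "\<And>a b. \<omega> a b = nijenhuis_prod P N a b"
  shows "generates_linear_deformation s P \<omega> \<and> trivial_linear_deformation s P \<omega>"
proof -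
  have \<omega>: "\<omega> = nijenhuis_prod P N"
    using assms(4) by (simp add: fun_eq_iff)
  have N: "module_hom s s N"
    using assms(3) by (simp add: nijenhuis_operator_def)
  have hom: "lsc_hom s (deformed_prod s P \<omega> t) s P (\<lambda>a. a + cscale s t (N a))" for t
    using nijenhuis_operator_lsc_hom[OF assms(1) nijenhuis_operator_id_plus[OF assms(1,3)]]
    unfolding nijenhuis_prod_id_plus[OF assms(1,3)] \<omega> .
  have "\<omega> \<in> cochains2 s"
    unfolding \<omega>
    using lsc_algebra.sesquilinear[OF nijenhuis_prod_lsc_algebra[OF assms(1,3)]] .
  \<comment> \<open>The witness for triviality is \<open>N\<close> itself. \<open>lsc_hom\<close>
    includes that its source is an \<open>lsc_algebra\<close>, so \<open>hom\<close> also gives the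
    left symmetry of every deformed product.\<close>
  with hom N show ?thesis
    unfolding generates_linear_deformation_def trivial_linear_deformation_def lsc_hom_def by blast
qed

end
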